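(* Let $K\ge 1$ be an integer and $\mathcal{X}=[K]=\{1,\dots,K\}$, with the categorical family $p(i|\theta)=\theta_i$ for $\theta\in\Theta=\Delta_K$ (the probability simplex in $\mathbb{R}^K$) and the Dirichlet conjugate prior family $$p(\theta|\alpha)=\frac{\Gamma(n)}{\prod_{i=1}^K\Gamma(\alpha_i)}\prod_{i=1}^K\theta_i^{\alpha_i-1},\qquad n=\sum_{i=1}^K\alpha_i,$$ for $\alpha\in\mathbb{R}^K$ with positive entries. Suppose the principal has two independent samples $x_1,x_2\in\mathcal{X}$. Then the mechanism $S$ on $\Delta_{\mathcal{X}}\times[0,1]\times\mathcal{X}\times\mathcal{X}$ defined by $$S(p,b,x_1,x_2)=\log p(x_1)+2b\cdot\mathbf{1}\{x_1=x_2\}-b^2$$ achieves optimal aggregation.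
   Context: Setting. The common-knowledge prior on $\theta$ is $p(\theta|\alpha^{0})$ for some known $\alpha^0\in\mathbb{R}^K$ with positive entries. A parameter $\theta^*$ is drawn from this prior. There are $m$ agents. Agent $i$ privately observes a finite (possibly empty) multiset $X^i$ of samples from $\mathcal{X}$, and the principal has two samples $x_1,x_2$. All samples are drawn independently from $p(\cdot|\theta^* )$ given $\theta^*$. The number of samples of each agent is not known to the principal. After observing $X^i$, agent $i$'s posterior on $\theta$ is the Dirichlet distribution $p(\theta|\alpha^0+c(X^i))$, where $c(X)\in\mathbb{R}^K$ is the vector whose $j$-th entry is the number of occurrences of $j$ in $X$. Agent $i$'s belief about $(x_1,x_2)$ is the joint law in which $\theta$ is drawn from this posterior and then $x_1,x_2$ are drawn independently from $p(\cdot|\theta)$. Global PPD. With $X=\uplus_i X^i$ (multiset sum), the global posterior predictive distribution is $p(x|X)=\int_\Theta p(x|\theta)\,p(\theta|\alpha^0+c(X))\,d\theta\in\Delta_{\mathcal{X}}$. Optimal aggregation. Each agent $i$ reports $r_i=(p_i,b_i)\in\Delta_{\mathcal{X}}\times[0,1]$ which is the (unique) maximizer of the expected score $\mathbb{E}[S(p,b,x_1,x_2)]$ under his belief about $(x_1,x_2)$, with the convention $\log 0=-\infty$. $S$ achieves optimal aggregation if these maximizers exist and are unique and there is a function $g:(\Delta_{\mathcal{X}}\times[0,1])^m\to\Delta_{\mathcal{X}}$ (which may depend on the known prior $\alpha^0$) such that for all finite multisets $X^1,\dots,X^m$ of elements of $\mathcal{X}$, with $X=\uplus_i X^i$, $g(r_1,\dots,r_m)=p(x|X)$.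 *)

theory Defs
  imports "HOL-Probability.Probability"
begin

text \<open>
  Vectors indexed by \<open>[K] = {1..K}\<close> are functions on \<^typ>\<open>nat\<close>. Points of the simplex are made
  extensional (\<^const>\<open>undefined\<close> off \<open>{1..K}\<close>), so equal coordinates mean equal points and
  uniqueness of a maximizer is meaningful.
\<close>

definition prob_simplex :: "nat \<Rightarrow> (nat \<Rightarrow> real) set" where
  "prob_simplex K = {\<theta> \<in> {1..K} \<rightarrow>\<^sub>E {0..}. (\<Sum>i=1..K. \<theta> i) = 1}"

text \<open>
  The reference measure \<open>d\<theta>\<close> on the simplex with respect to which the Dirichlet density has
  normalizing constant \<open>\<Gamma>(n) / \<Prod>i. \<Gamma>(\<alpha>\<^sub>i)\<close>: Lebesgue measure in the free coordinates
  \<open>\<theta>\<^sub>1, \<dots>, \<theta>\<^sub>K\<^sub>-\<^sub>1\<close>, with \<open>\<theta>\<^sub>K = 1 - \<theta>\<^sub>1 - \<dots> - \<theta>\<^sub>K\<^sub>-\<^sub>1\<close>. For \<open>K = 1\<close> the product over the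
  empty index set makes it the unit point mass.
\<close>

definition simplex_lborel :: "nat \<Rightarrow> (nat \<Rightarrow> real) measure" where
  "simplex_lborel K =
     restrict_space
       (distr (\<Pi>\<^sub>M i\<in>{1..<K}. lborel) (\<Pi>\<^sub>M i\<in>{1..K}. borel)
          (\<lambda>t. \<lambda>i\<in>{1..K}. if i = K then 1 - (\<Sum>j=1..<K. t j) else t i))
       (prob_simplex K)"

text \<open>
  Here \<open>0 powr 0 = 0\<close>, so for \<open>\<alpha>\<^sub>i = 1\<close> the value on the face \<open>\<theta>\<^sub>i = 0\<close> differs from the
  convention \<open>0\<^sup>0 = 1\<close>; that face is a null set of \<^const>\<open>simplex_lborel\<close>.
\<close>

definition dirichlet_density :: "nat \<Rightarrow> (nat \<Rightarrow> real) \<Rightarrow> (nat \<Rightarrow> real) \<Rightarrow> real" where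
  "dirichlet_density K \<alpha> \<theta> =
     Gamma (\<Sum>i=1..K. \<alpha> i) / (\<Prod>i=1..K. Gamma (\<alpha> i)) * (\<Prod>i=1..K. \<theta> i powr (\<alpha> i - 1))"

definition dirichlet :: "nat \<Rightarrow> (nat \<Rightarrow> real) \<Rightarrow> (nat \<Rightarrow> real) measure" where
  "dirichlet K \<alpha> = density (simplex_lborel K) (\<lambda>\<theta>. ennreal (dirichlet_density K \<alpha> \<theta>))"

definition categorical :: "nat \<Rightarrow> (nat \<Rightarrow> real) \<Rightarrow> nat measure" where
  "categorical K \<theta> = point_measure {1..K} (\<lambda>i. ennreal (\<theta> i))"

definition posterior_param :: "(nat \<Rightarrow> real) \<Rightarrow> nat multiset \<Rightarrow> nat \<Rightarrow> real" where
  "posterior_param \<alpha> X = (\<lambda>j. \<alpha> j + real (count X j))"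

definition belief :: "nat \<Rightarrow> (nat \<Rightarrow> real) \<Rightarrow> nat multiset \<Rightarrow> (nat \<times> nat) measure" where
  "belief K \<alpha> X =
     dirichlet K (posterior_param \<alpha> X) \<bind> (\<lambda>\<theta>. categorical K \<theta> \<Otimes>\<^sub>M categorical K \<theta>)"

definition posterior_predictive :: "nat \<Rightarrow> (nat \<Rightarrow> real) \<Rightarrow> nat multiset \<Rightarrow> nat \<Rightarrow> real" where
  "posterior_predictive K \<alpha> X =
     (\<lambda>x\<in>{1..K}. LINT \<theta>|simplex_lborel K. \<theta> x * dirichlet_density K (posterior_param \<alpha> X) \<theta>)"

text \<open>
  Expectation of an extended-real random variable as the difference of the integrals of its
  positive and negative parts; \<^const>\<open>e2ennreal\<close> maps negative numbers to \<open>0\<close>.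
\<close>

definition ereal_expectation :: "'a measure \<Rightarrow> ('a \<Rightarrow> ereal) \<Rightarrow> ereal" where
  "ereal_expectation M f =
     enn2ereal (\<integral>\<^sup>+ x. e2ennreal (f x) \<partial>M) - enn2ereal (\<integral>\<^sup>+ x. e2ennreal (- f x) \<partial>M)"

type_synonym mechanism = "(nat \<Rightarrow> real) \<Rightarrow> real \<Rightarrow> nat \<Rightarrow> nat \<Rightarrow> ereal"

definition report_space :: "nat \<Rightarrow> ((nat \<Rightarrow> real) \<times> real) set" where
  "report_space K = prob_simplex K \<times> {0..1}"

definition expected_score ::
  "nat \<Rightarrow> (nat \<Rightarrow> real) \<Rightarrow> mechanism \<Rightarrow> nat multiset \<Rightarrow> (nat \<Rightarrow> real) \<times> real \<Rightarrow> ereal" where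
  "expected_score K \<alpha> S X r =
     ereal_expectation (belief K \<alpha> X) (\<lambda>(x1, x2). S (fst r) (snd r) x1 x2)"

definition optimal_report ::
  "nat \<Rightarrow> (nat \<Rightarrow> real) \<Rightarrow> mechanism \<Rightarrow> nat multiset \<Rightarrow> (nat \<Rightarrow> real) \<times> real \<Rightarrow> bool" where
  "optimal_report K \<alpha> S X r \<longleftrightarrow>
     is_arg_max (expected_score K \<alpha> S X) (\<lambda>r. r \<in> report_space K) r"

definition achieves_optimal_aggregation ::
  "nat \<Rightarrow> (nat \<Rightarrow> real) \<Rightarrow> nat \<Rightarrow> mechanism \<Rightarrow> bool" where
  "achieves_optimal_aggregation K \<alpha> m S \<longleftrightarrow>
     (\<forall>X. set_mset X \<subseteq> {1..K} \<longrightarrow> (\<exists>!r. optimal_report K \<alpha> S X r)) \<and>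
     (\<exists>g \<in> ({1..m} \<rightarrow>\<^sub>E report_space K) \<rightarrow> prob_simplex K.
        \<forall>X :: nat \<Rightarrow> nat multiset. (\<forall>i\<in>{1..m}. set_mset (X i) \<subseteq> {1..K}) \<longrightarrow>
          g (\<lambda>i\<in>{1..m}. THE r. optimal_report K \<alpha> S (X i) r) =
          posterior_predictive K \<alpha> (\<Sum>i=1..m. X i))"

text \<open>Logarithm with \<open>log 0 = -\<infinity>\<close>, unlike \<^const>\<open>ln\<close>, for which \<open>ln 0 = 0\<close>.\<close>

definition ext_ln :: "real \<Rightarrow> ereal" where
  "ext_ln x = (if x = 0 then -\<infinity> else ereal (ln x))"

definition log_quadratic_mechanism :: mechanism where
  "log_quadratic_mechanism p b x1 x2 =
     ext_ln (p x1) + ereal (2 * b * of_bool (x1 = x2) - b\<^sup>2)"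

end

theory Submission
  imports Defs
begin

text \<open>
  For \<open>\<beta> = \<alpha>\<^sup>0 + c(X)\<close> with total mass \<open>n\<close>, the belief gives the pair \<open>(x, y)\<close> the weight
  \<open>\<beta>\<^sub>x (\<beta>\<^sub>y + [x = y]) / (n (n + 1))\<close>, so the expected score is
  \<open>(\<Sum>x. P\<^sub>x ln p\<^sub>x) + q\<^sup>2 - (b - q)\<^sup>2\<close>, where \<open>P = \<beta> / n\<close> is the predictive distribution and \<open>q\<close> the
  probability of \<open>x\<^sub>1 = x\<^sub>2\<close>. By Gibbs' inequality the unique maximizer is \<open>(P, q)\<close>. For \<open>K \<ge> 2\<close> the
  pair \<open>(P, q)\<close> determines \<open>n\<close>, hence \<open>\<beta>\<close> and the multiset \<open>X\<close>, so the principal can pool all the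
  samples; for \<open>K = 1\<close> the predictive distribution is constant.
\<close>

section \<open>The Dirichlet integral\<close>

text \<open>With the cut-off at \<open>0\<close>, the monomial \<open>\<Prod>i. \<theta>\<^sub>i powr (\<alpha>\<^sub>i - 1)\<close> restricted to the simplex is a
  product of kernels, and the Dirichlet integral becomes an iterated convolution.\<close>

definition beta_kernel :: "real \<Rightarrow> real \<Rightarrow> ennreal" where
  "beta_kernel a x = ennreal (if 0 < x then x powr (a - 1) else 0)"

lemma beta_kernel_measurable [measurable]: "beta_kernel a \<in> borel_measurable borel"
  unfolding beta_kernel_def by measurable

lemma beta_kernel_scale:
  assumes "s > 0"
  shows "beta_kernel a (s * x) = ennreal (s powr (a - 1)) * beta_kernel a x"
  using assms by (auto simp: beta_kernel_def powr_mult zero_less_mult_iff simp flip: ennreal_mult)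

text \<open>Outside \<open>{0..1}\<close> one of the two cut-offs vanishes, so what remains is
  Euler's Beta integrand. At the endpoints \<open>0 powr r = 0\<close> agrees with the
  cut-off.\<close>

lemma beta_kernel_convolution_one:
  assumes "a > 0" "b > 0"
  shows "(\<integral>\<^sup>+ t. beta_kernel a t * beta_kernel b (1 - t) \<partial>lborel) = ennreal (Beta a b)"
proof -
  have "(\<integral>\<^sup>+ t. beta_kernel a t * beta_kernel b (1 - t) \<partial>lborel) =
        (\<integral>\<^sup>+ t. ennreal (indicator {0..1} t * (t powr (a - 1) * (1 - t) powr (b - 1))) \<partial>lborel)"
    by (intro nn_integral_cong)
       (auto simp: beta_kernel_def indicator_def not_less simp flip: ennreal_mult)
  also have "\<dots> = ennreal (Beta a b)"
    using nn_integral_has_integral_lebesgue[OF _ has_integral_Beta_real[OF assms]] by simp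
  finally show ?thesis .
qed

text \<open>For \<open>s > 0\<close> the substitution \<open>t = s * u\<close> reduces to total 1:
  the kernels contribute the powers \<open>a - 1\<close> and \<open>b - 1\<close> of
  \<open>s\<close>, and the Jacobian contributes one more, giving the exponent
  \<open>a + b - 1\<close>. For \<open>s \<le> 0\<close> the arguments \<open>t\<close> and
  \<open>s - t\<close> are never both positive, so both sides are 0.\<close>

lemma beta_kernel_convolution:
  assumes a: "a > 0" and b: "b > 0"
  shows "(\<integral>\<^sup>+ t. beta_kernel a t * beta_kernel b (s - t) \<partial>lborel) =
         ennreal (Beta a b) * beta_kernel (a + b) s"
proof (cases "s > 0")
  case True
  have "(\<integral>\<^sup>+ t. beta_kernel a t * beta_kernel b (s - t) \<partial>lborel) =
        ennreal s * (\<integral>\<^sup>+ u. beta_kernel a (s * u) * beta_kernel b (s * (1 - u)) \<partial>lborel)"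
    using True by (subst nn_integral_real_affine[of _ s 0]) (auto simp: right_diff_distrib)
  also have "\<dots> = ennreal s * (\<integral>\<^sup>+ u. ennreal (s powr (a - 1)) * ennreal (s powr (b - 1)) *
      (beta_kernel a u * beta_kernel b (1 - u)) \<partial>lborel)"
    unfolding beta_kernel_scale[OF True] by (simp only: mult_ac)
  also have "\<dots> = ennreal s * (ennreal (s powr (a - 1)) * ennreal (s powr (b - 1)) * ennreal (Beta a b))"
    by (subst nn_integral_cmult) (auto simp: beta_kernel_convolution_one[OF a b])
  also have "\<dots> = ennreal (Beta a b) * beta_kernel (a + b) s"
  proof -
    have "s * (s powr (a - 1) * s powr (b - 1)) = s powr (a + b - 1)"
      using True powr_add[of s 1 "a - 1 + (b - 1)"] by (simp add: powr_add[symmetric] algebra_simps)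
    then have "ennreal s * (ennreal (s powr (a - 1)) * ennreal (s powr (b - 1))) = beta_kernel (a + b) s"
      using True by (simp add: beta_kernel_def flip: ennreal_mult)
    then show ?thesis by (metis mult.assoc mult.commute)
  qed
  finally show ?thesis .
next
  case False
  then have "beta_kernel a t * beta_kernel b (s - t) = 0" for t
    by (auto simp: beta_kernel_def)
  with False show ?thesis by (simp only:) (simp add: beta_kernel_def)
qed

text \<open>The kernel with exponent \<open>b\<close> stands for the dependent coordinate, which
  receives the mass left over from \<open>s\<close>. Each induction step integrates out one more
  coordinate \<open>y\<close> by a single convolution. It needs the hypothesis at total
  \<open>s - y\<close>, hence the generalization over \<open>s\<close>.\<close>

lemma dirichlet_integral:
  assumes "finite J" "\<And>j. j \<in> J \<Longrightarrow> a j > 0" and b: "b > 0"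
  shows "(\<integral>\<^sup>+ t. (\<Prod>j\<in>J. beta_kernel (a j) (t j)) * beta_kernel b (s - (\<Sum>j\<in>J. t j))
            \<partial>(\<Pi>\<^sub>M j\<in>J. lborel)) =
         ennreal ((\<Prod>j\<in>J. Gamma (a j)) * Gamma b / Gamma ((\<Sum>j\<in>J. a j) + b)) *
         beta_kernel ((\<Sum>j\<in>J. a j) + b) s"
  using assms(1,2)
proof (induction J arbitrary: s)
  case empty
  show ?case using Gamma_real_pos[OF b] by (simp add: PiM_empty)
next
  case (insert i J)
  interpret product_sigma_finite "\<lambda>_::'a. lborel :: real measure" by standard
  define A where "A = (\<Sum>j\<in>J. a j)"
  define C where "C = (\<Prod>j\<in>J. Gamma (a j)) * Gamma b / Gamma (A + b)"
  have ai: "a i > 0" and A: "A \<ge> 0"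
    using insert.prems by (auto simp: A_def less_imp_le intro!: sum_nonneg)
  have C: "C \<ge> 0" unfolding C_def using b A insert.prems
    by (intro divide_nonneg_pos mult_nonneg_nonneg prod_nonneg)
       (auto intro!: less_imp_le Gamma_real_pos)
  have IH: "(\<integral>\<^sup>+ t. (\<Prod>j\<in>J. beta_kernel (a j) (t j)) * beta_kernel b (s - (\<Sum>j\<in>J. t j))
            \<partial>(\<Pi>\<^sub>M j\<in>J. lborel)) = ennreal C * beta_kernel (A + b) s" for s
    unfolding A_def C_def by (rule insert.IH) (use insert.prems in auto)
  have "(\<integral>\<^sup>+ t. (\<Prod>j\<in>insert i J. beta_kernel (a j) (t j)) *
           beta_kernel b (s - (\<Sum>j\<in>insert i J. t j)) \<partial>(\<Pi>\<^sub>M j\<in>insert i J. lborel)) =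
        (\<integral>\<^sup>+ y. (\<integral>\<^sup>+ t. (\<Prod>j\<in>insert i J. beta_kernel (a j) ((t(i := y)) j)) *
           beta_kernel b (s - (\<Sum>j\<in>insert i J. (t(i := y)) j)) \<partial>(\<Pi>\<^sub>M j\<in>J. lborel)) \<partial>lborel)"
    by (rule product_nn_integral_insert_rev[OF insert.hyps]) measurable
  also have "\<dots> = (\<integral>\<^sup>+ y. (\<integral>\<^sup>+ t. beta_kernel (a i) y * ((\<Prod>j\<in>J. beta_kernel (a j) (t j)) *
           beta_kernel b ((s - y) - (\<Sum>j\<in>J. t j))) \<partial>(\<Pi>\<^sub>M j\<in>J. lborel)) \<partial>lborel)"
  proof -
    have "(\<Prod>j\<in>J. beta_kernel (a j) ((t(i := y)) j)) = (\<Prod>j\<in>J. beta_kernel (a j) (t j))"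
      and "(\<Sum>j\<in>J. (t(i := y)) j) = (\<Sum>j\<in>J. t j)" for t y
      using insert.hyps by (auto intro!: prod.cong sum.cong)
    then show ?thesis using insert.hyps by (simp add: mult_ac diff_diff_eq)
  qed
  also have "\<dots> = (\<integral>\<^sup>+ y. ennreal C * (beta_kernel (a i) y * beta_kernel (A + b) (s - y)) \<partial>lborel)"
    by (subst nn_integral_cmult) (auto simp: IH mult_ac)
  also have "\<dots> = ennreal C * (ennreal (Beta (a i) (A + b)) * beta_kernel (a i + (A + b)) s)"
    using ai A b by (subst nn_integral_cmult) (auto simp: beta_kernel_convolution)
  also have "\<dots> = ennreal (C * Beta (a i) (A + b)) * beta_kernel (a i + (A + b)) s"
    using C by (simp add: ennreal_mult' mult_ac)
  \<comment> \<open>The Gamma quotients telescope: the denominator \<open>Gamma (A + b)\<close> of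
    \<open>C\<close> cancels against the numerator of the new Beta factor.\<close>
  also have "C * Beta (a i) (A + b) =
      (\<Prod>j\<in>insert i J. Gamma (a j)) * Gamma b / Gamma ((\<Sum>j\<in>insert i J. a j) + b)"
    using insert.hyps Gamma_real_pos[OF add_nonneg_pos[OF A b]]
    by (simp add: C_def Beta_def A_def[symmetric] add_ac mult_ac)
  also have "a i + (A + b) = (\<Sum>j\<in>insert i J. a j) + b"
    using insert.hyps by (simp add: A_def add_ac)
  finally show ?case .
qed

section \<open>The Dirichlet integral on the simplex, through its free coordinates\<close>

lemma prob_simplex_sets [measurable]: "prob_simplex K \<in> sets (\<Pi>\<^sub>M i\<in>{1..K}. borel)"
proof -
  have "prob_simplex K = {\<theta> \<in> space (\<Pi>\<^sub>M i\<in>{1..K}. borel :: real measure).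
          (\<forall>i\<in>{1..K}. 0 \<le> \<theta> i) \<and> (\<Sum>i=1..K. \<theta> i) = 1}"
    by (auto simp: prob_simplex_def space_PiM PiE_iff)
  also have "\<dots> \<in> sets (\<Pi>\<^sub>M i\<in>{1..K}. borel)" by measurable
  finally show ?thesis .
qed

lemma space_simplex_lborel: "space (simplex_lborel K) = prob_simplex K"
  using sets.sets_into_space[OF prob_simplex_sets[of K]]
  by (auto simp: simplex_lborel_def space_restrict_space)

lemma measurable_simplex_lborel:
  "f \<in> (\<Pi>\<^sub>M i\<in>{1..K}. borel) \<rightarrow>\<^sub>M N \<Longrightarrow> f \<in> simplex_lborel K \<rightarrow>\<^sub>M N"
  unfolding simplex_lborel_def by (rule measurable_restrict_space1) simp

lemma nn_integral_simplex_monomial: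
  assumes K: "K \<ge> 1" and pos: "\<forall>j\<in>{1..K}. \<alpha> j > 0"
  shows "(\<integral>\<^sup>+ \<theta>. ennreal (\<Prod>i=1..K. \<theta> i powr (\<alpha> i - 1)) \<partial>simplex_lborel K) =
         ennreal ((\<Prod>i=1..K. Gamma (\<alpha> i)) / Gamma (\<Sum>i=1..K. \<alpha> i))"
proof -
  have ivl: "{1..K} = insert K {1..<K}" using K by auto
  let ?\<phi> = "\<lambda>t. \<lambda>i\<in>{1..K}. if i = K then 1 - (\<Sum>j=1..<K. t j) else t i :: real"
  have phi: "?\<phi> \<in> (\<Pi>\<^sub>M i\<in>{1..<K}. lborel) \<rightarrow>\<^sub>M (\<Pi>\<^sub>M i\<in>{1..K}. borel)"
    by (rule measurable_restrict, rename_tac i, case_tac "i = K") auto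
  \<comment> \<open>On the hyperplane of total mass 1, leaving the simplex means having a negative
    coordinate, and there the cut-off kills the product. On the faces both sides follow
    \<open>0 powr r = 0\<close>.\<close>
  have eq: "ennreal (\<Prod>i=1..K. \<theta> i powr (\<alpha> i - 1)) * indicator (prob_simplex K) \<theta> =
        (\<Prod>i=1..K. beta_kernel (\<alpha> i) (\<theta> i))"
    if "\<theta> \<in> extensional {1..K}" "(\<Sum>i=1..K. \<theta> i) = 1" for \<theta> :: "nat \<Rightarrow> real"
  proof (cases "\<theta> \<in> prob_simplex K")
    case True
    then have "beta_kernel (\<alpha> i) (\<theta> i) = ennreal (\<theta> i powr (\<alpha> i - 1))" if "i \<in> {1..K}" for i
    proof -
      have "\<theta> i \<ge> 0" using True that unfolding prob_simplex_def by (blast dest: PiE_mem)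
      then show ?thesis by (auto simp: beta_kernel_def)
    qed
    with True show ?thesis by (simp add: prod_ennreal)
  next
    case False
    then have "\<exists>i\<in>{1..K}. \<theta> i < 0"
      using that unfolding prob_simplex_def by (auto simp: PiE_def Pi_def not_le)
    then obtain i where "i \<in> {1..K}" "\<theta> i < 0" by blast
    then have "(\<Prod>i=1..K. beta_kernel (\<alpha> i) (\<theta> i)) = 0"
      by (intro prod_zero) (auto simp: beta_kernel_def intro!: bexI[of _ i])
    with False show ?thesis by simp
  qed
  have last_sum: "(\<Sum>i=1..K. f i) = (\<Sum>i=1..<K. f i) + f K" for f :: "nat \<Rightarrow> real"
    unfolding ivl by (subst sum.insert) auto
  have last_prod: "(\<Prod>i=1..K. f i) = (\<Prod>i=1..<K. f i) * f K" for f :: "nat \<Rightarrow> 'b::comm_monoid_mult"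
    unfolding ivl by (subst prod.insert) (auto simp: mult.commute)
  let ?F = "\<lambda>\<theta>. ennreal (\<Prod>i=1..K. \<theta> i powr (\<alpha> i - 1))"
  have "(\<integral>\<^sup>+ \<theta>. ?F \<theta> \<partial>simplex_lborel K) = (\<integral>\<^sup>+ \<theta>. ?F \<theta> * indicator (prob_simplex K) \<theta>
      \<partial>distr (\<Pi>\<^sub>M i\<in>{1..<K}. lborel) (\<Pi>\<^sub>M i\<in>{1..K}. borel) ?\<phi>)"
    unfolding simplex_lborel_def
    by (rule nn_integral_restrict_space) (simp only: sets_distr space_distr sets.Int prob_simplex_sets sets.top)
  also have "\<dots> = (\<integral>\<^sup>+ t. ?F (?\<phi> t) * indicator (prob_simplex K) (?\<phi> t) \<partial>(\<Pi>\<^sub>M i\<in>{1..<K}. lborel))"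
    by (rule nn_integral_distr[OF phi]) measurable
  also have "\<dots> = (\<integral>\<^sup>+ t. (\<Prod>i=1..<K. beta_kernel (\<alpha> i) (t i)) *
        beta_kernel (\<alpha> K) (1 - (\<Sum>i=1..<K. t i)) \<partial>(\<Pi>\<^sub>M i\<in>{1..<K}. lborel))"
  proof (rule nn_integral_cong)
    fix t :: "nat \<Rightarrow> real"
    have phi_last: "?\<phi> t K = 1 - (\<Sum>i=1..<K. t i)" using K by simp
    have phi_free: "?\<phi> t i = t i" if "i \<in> {1..<K}" for i using that by simp
    have "(\<Sum>i=1..<K. ?\<phi> t i) = (\<Sum>i=1..<K. t i)"
      by (rule sum.cong[OF refl phi_free])
    then have s: "(\<Sum>i=1..K. ?\<phi> t i) = 1"
      unfolding last_sum phi_last by simp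
    have "(\<Prod>i=1..<K. beta_kernel (\<alpha> i) (?\<phi> t i)) = (\<Prod>i=1..<K. beta_kernel (\<alpha> i) (t i))"
      by (rule prod.cong[OF refl]) (simp only: phi_free)
    then have "(\<Prod>i=1..K. beta_kernel (\<alpha> i) (?\<phi> t i)) =
        (\<Prod>i=1..<K. beta_kernel (\<alpha> i) (t i)) * beta_kernel (\<alpha> K) (1 - (\<Sum>i=1..<K. t i))"
      unfolding last_prod phi_last by simp
    then show "?F (?\<phi> t) * indicator (prob_simplex K) (?\<phi> t) =
        (\<Prod>i=1..<K. beta_kernel (\<alpha> i) (t i)) * beta_kernel (\<alpha> K) (1 - (\<Sum>i=1..<K. t i))"
      by (rule trans[OF eq[OF restrict_extensional s]])
  qed
  \<comment> \<open>The total is \<open>s = 1\<close>, where the remaining kernel takes the value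
    1.\<close>
  also have "\<dots> = ennreal ((\<Prod>i=1..<K. Gamma (\<alpha> i)) * Gamma (\<alpha> K) / Gamma ((\<Sum>i=1..<K. \<alpha> i) + \<alpha> K)) *
      beta_kernel ((\<Sum>i=1..<K. \<alpha> i) + \<alpha> K) 1"
    using K pos by (intro dirichlet_integral) auto
  also have "\<dots> = ennreal ((\<Prod>i=1..K. Gamma (\<alpha> i)) / Gamma (\<Sum>i=1..K. \<alpha> i))"
    unfolding last_sum last_prod by (simp add: beta_kernel_def)
  finally show ?thesis .
qed

section \<open>Moments of the Dirichlet distribution\<close>

lemma sum_param_pos:
  fixes \<alpha> :: "nat \<Rightarrow> real"
  assumes "K \<ge> 1" "\<forall>j\<in>{1..K}. \<alpha> j > 0"
  shows "(\<Sum>i=1..K. \<alpha> i) > 0"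
  using assms by (intro sum_pos) auto

lemma dirichlet_density_measurable [measurable]:
  "dirichlet_density K \<alpha> \<in> borel_measurable (simplex_lborel K)"
  unfolding dirichlet_density_def by (rule measurable_simplex_lborel) measurable

lemma component_measurable [measurable]:
  "x \<in> {1..K} \<Longrightarrow> (\<lambda>\<theta>. \<theta> x) \<in> borel_measurable (simplex_lborel K)"
  by (rule measurable_simplex_lborel) measurable

lemma dirichlet_density_nonneg:
  assumes "K \<ge> 1" "\<forall>j\<in>{1..K}. \<alpha> j > 0"
  shows "dirichlet_density K \<alpha> \<theta> \<ge> 0"
  unfolding dirichlet_density_def using assms sum_param_pos[OF assms]
  by (intro mult_nonneg_nonneg divide_nonneg_nonneg prod_nonneg)
     (auto intro!: less_imp_le[OF Gamma_real_pos])

lemma nn_integral_dirichlet_density: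
  assumes "K \<ge> 1" "\<forall>j\<in>{1..K}. \<alpha> j > 0"
  shows "(\<integral>\<^sup>+ \<theta>. ennreal (dirichlet_density K \<alpha> \<theta>) \<partial>simplex_lborel K) = 1"
proof -
  let ?n = "\<Sum>i=1..K. \<alpha> i" and ?G = "\<Prod>i=1..K. Gamma (\<alpha> i)"
  have G: "Gamma ?n > 0" "?G > 0"
    using assms sum_param_pos[OF assms] by (auto intro!: prod_pos Gamma_real_pos)
  have [measurable]: "(\<lambda>\<theta>. ennreal (\<Prod>i=1..K. \<theta> i powr (\<alpha> i - 1))) \<in> borel_measurable (simplex_lborel K)"
    by (rule measurable_simplex_lborel) measurable
  have "(\<integral>\<^sup>+ \<theta>. ennreal (dirichlet_density K \<alpha> \<theta>) \<partial>simplex_lborel K) =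
        (\<integral>\<^sup>+ \<theta>. ennreal (Gamma ?n / ?G) * ennreal (\<Prod>i=1..K. \<theta> i powr (\<alpha> i - 1)) \<partial>simplex_lborel K)"
    unfolding dirichlet_density_def using G by (intro nn_integral_cong ennreal_mult') simp
  also have "\<dots> = ennreal (Gamma ?n / ?G) * ennreal (?G / Gamma ?n)"
    using nn_integral_simplex_monomial[OF assms] by (subst nn_integral_cmult) simp_all
  also have "\<dots> = 1"
  proof -
    have "ennreal (u / v) * ennreal (v / u) = 1" if "u > 0" "v > 0" for u v :: real
      using that by (simp flip: ennreal_mult)
    from this[OF G] show ?thesis .
  qed
  finally show ?thesis .
qed

text \<open>A factor \<open>\<theta> x\<close> raises the exponent at \<open>x\<close> by one, and
  \<open>Gamma (z + 1) = z * Gamma z\<close> at \<open>\<alpha> x\<close> and at the total mass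
  accounts for the constant. This reduces every moment to the normalization of a Dirichlet density
  with a shifted parameter.\<close>

lemma component_times_dirichlet_density:
  assumes K: "K \<ge> 1" and pos: "\<forall>j\<in>{1..K}. \<alpha> j > 0"
    and x: "x \<in> {1..K}" and \<theta>: "\<theta> \<in> prob_simplex K"
  shows "\<theta> x * dirichlet_density K \<alpha> \<theta> =
         \<alpha> x / (\<Sum>i=1..K. \<alpha> i) * dirichlet_density K (\<alpha>(x := \<alpha> x + 1)) \<theta>"
proof -
  have ivl: "{1..K} = insert x ({1..K} - {x})" using x by auto
  let ?B = "{1..K} - {x}"
  let ?\<alpha>' = "\<alpha>(x := \<alpha> x + 1)"
  let ?n = "\<Sum>i=1..K. \<alpha> i"
  have ax: "\<alpha> x > 0" and n: "?n > 0" using pos x sum_param_pos[OF K pos] by auto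
  have B: "(\<Prod>i\<in>?B. Gamma (?\<alpha>' i)) = (\<Prod>i\<in>?B. Gamma (\<alpha> i))"
    "(\<Prod>i\<in>?B. \<theta> i powr (?\<alpha>' i - 1)) = (\<Prod>i\<in>?B. \<theta> i powr (\<alpha> i - 1))"
    "(\<Sum>i\<in>?B. ?\<alpha>' i) = (\<Sum>i\<in>?B. \<alpha> i)"
    by (auto intro!: prod.cong sum.cong)
  have sn: "(\<Sum>i=1..K. ?\<alpha>' i) = ?n + 1"
    by (subst (1 2) ivl, subst (1 2) sum.insert) (auto simp: B)
  have gx: "Gamma (\<alpha> x + 1) = \<alpha> x * Gamma (\<alpha> x)" and gn: "Gamma (?n + 1) = ?n * Gamma ?n"
    using ax n by (auto intro!: Gamma_plus1 simp: nonpos_Ints_def)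
  have pg: "(\<Prod>i=1..K. Gamma (?\<alpha>' i)) = \<alpha> x * (\<Prod>i=1..K. Gamma (\<alpha> i))"
    by (subst (1 2) ivl, subst (1 2) prod.insert) (auto simp: B gx)
  have "\<theta> x \<ge> 0" using \<theta> x by (auto simp: prob_simplex_def)
  \<comment> \<open>The face \<open>\<theta> x = 0\<close> needs its own case, where
    \<open>0 powr r = 0\<close> makes both sides vanish.\<close>
  then have "\<theta> x powr \<alpha> x = \<theta> x * \<theta> x powr (\<alpha> x - 1)"
    using ax by (cases "\<theta> x = 0") (auto simp: powr_diff)
  then have pp: "(\<Prod>i=1..K. \<theta> i powr (?\<alpha>' i - 1)) = \<theta> x * (\<Prod>i=1..K. \<theta> i powr (\<alpha> i - 1))"
    by (subst (1 2) ivl, subst (1 2) prod.insert) (auto simp: B)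
  show ?thesis
    unfolding dirichlet_density_def sn gn pg pp using ax n by simp
qed

lemma simplex_nonneg: "\<theta> \<in> prob_simplex K \<Longrightarrow> i \<in> {1..K} \<Longrightarrow> \<theta> i \<ge> 0"
  unfolding prob_simplex_def by (blast dest: PiE_mem)

lemma simplex_sum: "\<theta> \<in> prob_simplex K \<Longrightarrow> (\<Sum>i=1..K. \<theta> i) = 1"
  by (simp add: prob_simplex_def)

lemma nn_integral_first_moment:
  assumes K: "K \<ge> 1" and pos: "\<forall>j\<in>{1..K}. \<alpha> j > 0" and x: "x \<in> {1..K}"
  shows "(\<integral>\<^sup>+ \<theta>. ennreal (\<theta> x * dirichlet_density K \<alpha> \<theta>) \<partial>simplex_lborel K) =
         ennreal (\<alpha> x / (\<Sum>i=1..K. \<alpha> i))"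
proof -
  have c: "\<alpha> x / (\<Sum>i=1..K. \<alpha> i) \<ge> 0" using sum_param_pos[OF K pos] pos x by (simp add: less_imp_le)
  have pos': "\<forall>j\<in>{1..K}. (\<alpha>(x := \<alpha> x + 1)) j > 0" using pos x by (auto simp: add_pos_pos)
  have "(\<integral>\<^sup>+ \<theta>. ennreal (\<theta> x * dirichlet_density K \<alpha> \<theta>) \<partial>simplex_lborel K) =
    (\<integral>\<^sup>+ \<theta>. ennreal (\<alpha> x / (\<Sum>i=1..K. \<alpha> i)) *
        ennreal (dirichlet_density K (\<alpha>(x := \<alpha> x + 1)) \<theta>) \<partial>simplex_lborel K)"
    by (intro nn_integral_cong)
       (simp only: component_times_dirichlet_density[OF K pos x] space_simplex_lborel ennreal_mult'[OF c])
  also have "\<dots> = ennreal (\<alpha> x / (\<Sum>i=1..K. \<alpha> i))"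
    by (subst nn_integral_cmult) (auto simp: nn_integral_dirichlet_density[OF K pos'])
  finally show ?thesis .
qed

text \<open>This is the law of the first two draws from a Polya urn with initial weights \<alpha>:
  drawing \<open>x\<close> adds one unit of weight to \<open>x\<close> before the second
  draw.\<close>

definition pair_weight :: "nat \<Rightarrow> (nat \<Rightarrow> real) \<Rightarrow> nat \<times> nat \<Rightarrow> real" where
  "pair_weight K \<alpha> = (\<lambda>(x, y).
     \<alpha> x / (\<Sum>i=1..K. \<alpha> i) * ((\<alpha> y + of_bool (x = y)) / ((\<Sum>i=1..K. \<alpha> i) + 1)))"

text \<open>Shifting the parameter at \<open>x\<close> absorbs the factor \<open>\<theta> x\<close>.
  What is left is a first moment for the shifted parameter, whose total mass is larger by one and
  whose entry at \<open>y\<close> is larger exactly when \<open>y = x\<close>.\<close>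

lemma nn_integral_second_moment:
  assumes K: "K \<ge> 1" and pos: "\<forall>j\<in>{1..K}. \<alpha> j > 0" and x: "x \<in> {1..K}" and y: "y \<in> {1..K}"
  shows "(\<integral>\<^sup>+ \<theta>. ennreal (\<theta> x * \<theta> y * dirichlet_density K \<alpha> \<theta>) \<partial>simplex_lborel K) =
         ennreal (pair_weight K \<alpha> (x, y))"
proof -
  let ?\<alpha>' = "\<alpha>(x := \<alpha> x + 1)"
  have c: "\<alpha> x / (\<Sum>i=1..K. \<alpha> i) \<ge> 0" using sum_param_pos[OF K pos] pos x by (simp add: less_imp_le)
  have pos': "\<forall>j\<in>{1..K}. ?\<alpha>' j > 0" using pos x by (auto simp: add_pos_pos)
  have n: "(\<Sum>i=1..K. ?\<alpha>' i) = (\<Sum>i=1..K. \<alpha> i) + 1"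
  proof -
    have "(\<Sum>i=1..K. ?\<alpha>' i) = (\<Sum>i=1..K. \<alpha> i + (if i = x then 1 else 0))"
      by (intro sum.cong) auto
    then show ?thesis using x by (simp add: sum.distrib)
  qed
  have "(\<integral>\<^sup>+ \<theta>. ennreal (\<theta> x * \<theta> y * dirichlet_density K \<alpha> \<theta>) \<partial>simplex_lborel K) =
    (\<integral>\<^sup>+ \<theta>. ennreal (\<alpha> x / (\<Sum>i=1..K. \<alpha> i)) *
        ennreal (\<theta> y * dirichlet_density K ?\<alpha>' \<theta>) \<partial>simplex_lborel K)"
  proof (rule nn_integral_cong)
    fix \<theta> assume "\<theta> \<in> space (simplex_lborel K)"
    then have "\<theta> x * \<theta> y * dirichlet_density K \<alpha> \<theta> =
        \<alpha> x / (\<Sum>i=1..K. \<alpha> i) * (\<theta> y * dirichlet_density K ?\<alpha>' \<theta>)"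
      using arg_cong[OF component_times_dirichlet_density[OF K pos x, of \<theta>], of "\<lambda>u. \<theta> y * u"]
      by (simp add: space_simplex_lborel mult_ac)
    then show "ennreal (\<theta> x * \<theta> y * dirichlet_density K \<alpha> \<theta>) = ennreal (\<alpha> x / (\<Sum>i=1..K. \<alpha> i)) *
        ennreal (\<theta> y * dirichlet_density K ?\<alpha>' \<theta>)"
      by (simp only: ennreal_mult'[OF c])
  qed
  also have "\<dots> = ennreal (\<alpha> x / (\<Sum>i=1..K. \<alpha> i)) * ennreal (?\<alpha>' y / ((\<Sum>i=1..K. \<alpha> i) + 1))"
    using y by (subst nn_integral_cmult) (simp_all add: nn_integral_first_moment[OF K pos' y] n[simplified])
  also have "\<dots> = ennreal (pair_weight K \<alpha> (x, y))"
    unfolding pair_weight_def prod.case ennreal_mult'[OF c] by (cases "x = y") auto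
  finally show ?thesis .
qed

lemma posterior_param_pos:
  assumes "\<forall>j\<in>{1..K}. \<alpha> j > 0"
  shows "\<forall>j\<in>{1..K}. posterior_param \<alpha> X j > 0"
  using assms by (simp add: posterior_param_def add_pos_nonneg)

lemma posterior_predictive_eq:
  assumes K: "K \<ge> 1" and pos: "\<forall>j\<in>{1..K}. \<alpha> j > 0"
  shows "posterior_predictive K \<alpha> X =
    (\<lambda>x\<in>{1..K}. posterior_param \<alpha> X x / (\<Sum>i=1..K. posterior_param \<alpha> X i))"
  unfolding posterior_predictive_def
proof (rule restrict_ext)
  fix x assume x: "x \<in> {1..K}"
  note pos' = posterior_param_pos[OF pos, of X]
  have "AE \<theta> in simplex_lborel K. 0 \<le> \<theta> x * dirichlet_density K (posterior_param \<alpha> X) \<theta>"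
    using x dirichlet_density_nonneg[OF K pos']
    by (intro AE_I2 mult_nonneg_nonneg) (auto simp: space_simplex_lborel intro: simplex_nonneg)
  moreover have "posterior_param \<alpha> X x / (\<Sum>i=1..K. posterior_param \<alpha> X i) \<ge> 0"
    using pos' x sum_param_pos[OF K pos'] by (simp add: less_imp_le)
  ultimately show "(LINT \<theta>|simplex_lborel K. \<theta> x * dirichlet_density K (posterior_param \<alpha> X) \<theta>) =
      posterior_param \<alpha> X x / (\<Sum>i=1..K. posterior_param \<alpha> X i)"
    using x by (intro has_bochner_integral_integral_eq has_bochner_integral_nn_integral
        nn_integral_first_moment[OF K pos']) measurable
qed

section \<open>The belief as a finite distribution\<close>

lemma sets_categorical [simp]: "sets (categorical K \<theta>) = Pow {1..K}"
  by (simp add: categorical_def sets_point_measure)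

lemma prob_space_categorical:
  assumes "\<theta> \<in> prob_simplex K"
  shows "prob_space (categorical K \<theta>)"
proof
  have "emeasure (categorical K \<theta>) (space (categorical K \<theta>)) = (\<Sum>i=1..K. ennreal (\<theta> i))"
    by (simp add: categorical_def space_point_measure emeasure_point_measure_finite)
  also have "\<dots> = ennreal (\<Sum>i=1..K. \<theta> i)"
    using simplex_nonneg[OF assms] by (intro sum_ennreal) auto
  finally show "emeasure (categorical K \<theta>) (space (categorical K \<theta>)) = 1"
    using simplex_sum[OF assms] by simp
qed

lemma sets_categorical_pair:
  "sets (categorical K \<theta> \<Otimes>\<^sub>M categorical K \<theta>) = Pow ({1..K} \<times> {1..K})"
proof -
  have "sets (categorical K \<theta> \<Otimes>\<^sub>M categorical K \<theta>) = sets (count_space {1..K} \<Otimes>\<^sub>M count_space {1..K})"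
    by (intro sets_pair_measure_cong) auto
  also have "count_space {1..K} \<Otimes>\<^sub>M count_space {1..K} = count_space ({1..K} \<times> {1..K})"
    by (intro pair_measure_countable) auto
  finally show ?thesis by simp
qed

lemma emeasure_categorical_pair:
  assumes \<theta>: "\<theta> \<in> prob_simplex K" and A: "A \<subseteq> {1..K} \<times> {1..K}"
  shows "emeasure (categorical K \<theta> \<Otimes>\<^sub>M categorical K \<theta>) A = (\<Sum>(x, y)\<in>A. ennreal (\<theta> x * \<theta> y))"
proof -
  interpret C: prob_space "categorical K \<theta>" by (rule prob_space_categorical[OF \<theta>])
  let ?M = "categorical K \<theta> \<Otimes>\<^sub>M categorical K \<theta>"
  have fin: "finite A" using A by (rule finite_subset) auto
  have "emeasure ?M A = (\<Sum>z\<in>A. emeasure ?M {z})"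
    using A fin by (intro emeasure_eq_sum_singleton) (auto simp: sets_categorical_pair)
  also have "\<dots> = (\<Sum>(x, y)\<in>A. ennreal (\<theta> x * \<theta> y))"
  proof (rule sum.cong[OF refl], clarify)
    fix x y assume "(x, y) \<in> A"
    then have xy: "x \<in> {1..K}" "y \<in> {1..K}" using A by auto
    have "emeasure ?M ({x} \<times> {y}) = emeasure (categorical K \<theta>) {x} * emeasure (categorical K \<theta>) {y}"
      using xy by (intro C.emeasure_pair_measure_Times) auto
    then show "emeasure ?M {(x, y)} = ennreal (\<theta> x * \<theta> y)"
      using xy simplex_nonneg[OF \<theta>]
      by (simp add: categorical_def emeasure_point_measure_finite ennreal_mult)
  qed
  finally show ?thesis .
qed

text \<open>The monadic bind in \<open>belief\<close> can be evaluated only for a measurable kernel.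
  Here the mass of a set of pairs is a finite sum of monomials in the coordinates of
  \<theta>.\<close>

lemma categorical_pair_measurable:
  "(\<lambda>\<theta>. categorical K \<theta> \<Otimes>\<^sub>M categorical K \<theta>) \<in>
     dirichlet K \<alpha> \<rightarrow>\<^sub>M subprob_algebra (count_space ({1..K} \<times> {1..K}))"
proof (rule measurable_subprob_algebra)
  fix \<theta> assume "\<theta> \<in> space (dirichlet K \<alpha>)"
  then have "prob_space (categorical K \<theta>)"
    by (intro prob_space_categorical) (simp add: dirichlet_def space_simplex_lborel)
  then interpret C: prob_space "categorical K \<theta>" .
  interpret pair_prob_space "categorical K \<theta>" "categorical K \<theta>" ..
  show "subprob_space (categorical K \<theta> \<Otimes>\<^sub>M categorical K \<theta>)"
    by (intro prob_space_imp_subprob_space P.prob_space_axioms)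
next
  fix A :: "(nat \<times> nat) set" assume A: "A \<in> sets (count_space ({1..K} \<times> {1..K}))"
  have "(\<lambda>\<theta>. \<Sum>(x, y)\<in>A. ennreal (\<theta> x * \<theta> y)) \<in> borel_measurable (simplex_lborel K)"
    unfolding case_prod_beta
  proof (rule borel_measurable_sum)
    fix z assume "z \<in> A"
    then have [measurable]: "fst z \<in> {1..K}" "snd z \<in> {1..K}" using A by auto
    show "(\<lambda>\<theta>. ennreal (\<theta> (fst z) * \<theta> (snd z))) \<in> borel_measurable (simplex_lborel K)"
      by measurable
  qed
  then show "(\<lambda>\<theta>. emeasure (categorical K \<theta> \<Otimes>\<^sub>M categorical K \<theta>) A) \<in> borel_measurable (dirichlet K \<alpha>)"
    using A unfolding dirichlet_def
    by (subst measurable_density_eq1, subst measurable_cong) (auto simp: space_simplex_lborel emeasure_categorical_pair)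
qed (auto simp: sets_categorical_pair)

text \<open>On a finite set it suffices to compare singletons, and the mass of a singleton under the
  mixture is a second moment of the Dirichlet distribution.\<close>

lemma belief_eq_point_measure:
  assumes K: "K \<ge> 1" and pos: "\<forall>j\<in>{1..K}. \<alpha> j > 0"
  shows "belief K \<alpha> X =
    point_measure ({1..K} \<times> {1..K}) (\<lambda>z. ennreal (pair_weight K (posterior_param \<alpha> X) z))"
proof -
  define \<beta> where "\<beta> = posterior_param \<alpha> X"
  have pos': "\<forall>j\<in>{1..K}. \<beta> j > 0" unfolding \<beta>_def by (rule posterior_param_pos[OF pos])
  have sp: "space (dirichlet K \<beta>) = prob_simplex K"
    by (simp add: dirichlet_def space_simplex_lborel)
  \<comment> \<open>A bind over an empty space has a default value. Emptiness is excluded because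
    the density integrates to 1 rather than 0.\<close>
  have ne: "space (dirichlet K \<beta>) \<noteq> {}"
    using nn_integral_dirichlet_density[OF K pos'] nn_integral_empty[of "simplex_lborel K"]
    by (auto simp: sp space_simplex_lborel)
  let ?C = "\<lambda>\<theta>. categorical K \<theta> \<Otimes>\<^sub>M categorical K \<theta>"
  show ?thesis unfolding belief_def \<beta>_def[symmetric]
  proof (rule measure_eqI_finite)
    show "sets (dirichlet K \<beta> \<bind> ?C) = Pow ({1..K} \<times> {1..K})"
      using sets_bind[of "dirichlet K \<beta>" ?C "count_space ({1..K} \<times> {1..K})"] ne
      by (simp add: sets_categorical_pair)
    fix z :: "nat \<times> nat" assume z: "z \<in> {1..K} \<times> {1..K}"
    obtain x y where zxy: "z = (x, y)" by fastforce
    with z have xy: "x \<in> {1..K}" "y \<in> {1..K}" by auto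
    have "emeasure (dirichlet K \<beta> \<bind> ?C) {z} = (\<integral>\<^sup>+ \<theta>. emeasure (?C \<theta>) {z} \<partial>dirichlet K \<beta>)"
      using z by (intro emeasure_bind[OF ne categorical_pair_measurable]) auto
    also have "\<dots> = (\<integral>\<^sup>+ \<theta>. ennreal (\<theta> x * \<theta> y) \<partial>dirichlet K \<beta>)"
      using z by (intro nn_integral_cong) (auto simp: sp zxy emeasure_categorical_pair)
    also have "\<dots> = (\<integral>\<^sup>+ \<theta>. ennreal (dirichlet_density K \<beta> \<theta>) * ennreal (\<theta> x * \<theta> y) \<partial>simplex_lborel K)"
      unfolding dirichlet_def using xy by (intro nn_integral_density) measurable
    also have "\<dots> = (\<integral>\<^sup>+ \<theta>. ennreal (\<theta> x * \<theta> y * dirichlet_density K \<beta> \<theta>) \<partial>simplex_lborel K)"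
      using dirichlet_density_nonneg[OF K pos'] by (simp add: mult.commute flip: ennreal_mult')
    also have "\<dots> = ennreal (pair_weight K \<beta> z)"
      unfolding zxy by (rule nn_integral_second_moment[OF K pos' xy])
    also have "\<dots> = emeasure (point_measure ({1..K} \<times> {1..K}) (\<lambda>z. ennreal (pair_weight K \<beta> z))) {z}"
      using z by (subst emeasure_point_measure_finite) auto
    finally show "emeasure (dirichlet K \<beta> \<bind> ?C) {z} =
      emeasure (point_measure ({1..K} \<times> {1..K}) (\<lambda>z. ennreal (pair_weight K \<beta> z))) {z}" .
  qed (auto simp: sets_point_measure)
qed

section \<open>Extended-real expectations over finite distributions, and Gibbs' inequality\<close>

text \<open>Since \<open>ennreal\<close> truncates negative reals to 0, the two integrals in the
  definition are the weighted sums of \<open>max 0 (f a)\<close> and \<open>max 0 (- f a)\<close>,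
  both finite, and their difference recombines to \<open>f\<close>.\<close>

lemma ereal_expectation_point_measure:
  assumes A: "finite A" and w: "\<And>a. a \<in> A \<Longrightarrow> w a \<ge> 0"
    and f: "\<And>a. a \<in> A \<Longrightarrow> g a = ereal (f a)"
  shows "ereal_expectation (point_measure A (\<lambda>a. ennreal (w a))) g = ereal (\<Sum>a\<in>A. w a * f a)"
proof -
  have part: "(\<Sum>a\<in>A. ennreal (w a) * ennreal (h a)) = ennreal (\<Sum>a\<in>A. w a * max 0 (h a))"
    for h :: "'a \<Rightarrow> real"
  proof -
    have "(\<Sum>a\<in>A. ennreal (w a) * ennreal (h a)) = (\<Sum>a\<in>A. ennreal (w a * max 0 (h a)))"
      using w by (intro sum.cong refl) (simp add: ennreal_mult' max_def ennreal_neg)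
    also have "\<dots> = ennreal (\<Sum>a\<in>A. w a * max 0 (h a))"
      using w by (intro sum_ennreal) simp
    finally show ?thesis .
  qed
  have nonneg: "(\<Sum>a\<in>A. w a * max 0 (h a)) \<ge> 0" for h :: "'a \<Rightarrow> real"
    using w by (intro sum_nonneg) simp
  have split: "(\<Sum>a\<in>A. w a * f a) = (\<Sum>a\<in>A. w a * max 0 (f a)) - (\<Sum>a\<in>A. w a * max 0 (- f a))"
    unfolding sum_subtractf[symmetric] by (intro sum.cong refl) (simp add: max_def)
  have "(\<Sum>a\<in>A. ennreal (w a) * e2ennreal (g a)) = ennreal (\<Sum>a\<in>A. w a * max 0 (f a))"
    "(\<Sum>a\<in>A. ennreal (w a) * e2ennreal (- g a)) = ennreal (\<Sum>a\<in>A. w a * max 0 (- f a))"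
    unfolding part[symmetric] using f by (auto intro!: sum.cong)
  then show ?thesis
    unfolding ereal_expectation_def nn_integral_point_measure_finite[OF A] split
    by (simp add: enn2ereal_ennreal nonneg)
qed

text \<open>A single atom of positive weight makes the negative part infinite. The positive part
  stays finite because \<open>g\<close> never takes the value \<open>\<infinity>\<close>, so no
  difference of two infinities arises.\<close>

lemma ereal_expectation_point_measure_MInf:
  assumes A: "finite A" and a: "a \<in> A" "w a > 0" "g a = -\<infinity>"
    and g: "\<And>b. b \<in> A \<Longrightarrow> g b \<noteq> \<infinity>"
  shows "ereal_expectation (point_measure A (\<lambda>a. ennreal (w a))) g = -\<infinity>"
proof -
  have "ennreal (w b) * e2ennreal (g b) \<noteq> \<top>" if "b \<in> A" for b
    using g[OF that] by (cases "g b") (auto simp: ennreal_mult_eq_top_iff e2ennreal_neg)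
  then have "(\<Sum>b\<in>A. ennreal (w b) * e2ennreal (g b)) \<noteq> \<top>"
    using A by simp
  moreover have "(\<Sum>b\<in>A. ennreal (w b) * e2ennreal (- g b)) = \<top>"
    using A a by (auto simp: ennreal_mult_eq_top_iff intro!: bexI[of _ a])
  ultimately show ?thesis
    unfolding ereal_expectation_def nn_integral_point_measure_finite[OF A]
    by (cases "\<Sum>b\<in>A. ennreal (w b) * e2ennreal (g b)") (auto simp: enn2ereal_ennreal)
qed

text \<open>The tangent bound \<open>ln u - ln v \<le> (u - v) / v\<close>, strict for
  \<open>u \<noteq> v\<close>, is multiplied by \<open>P i\<close> and summed. The linear terms
  \<open>p i - P i\<close> cancel because the two totals agree.\<close>

lemma gibbs_inequality:
  fixes P p :: "'a \<Rightarrow> real"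
  assumes A: "finite A" and P: "\<And>i. i \<in> A \<Longrightarrow> P i > 0" and p: "\<And>i. i \<in> A \<Longrightarrow> p i > 0"
    and sum: "sum p A = sum P A"
    and ne: "\<exists>i\<in>A. p i \<noteq> P i"
  shows "(\<Sum>i\<in>A. P i * ln (p i)) < (\<Sum>i\<in>A. P i * ln (P i))"
proof -
  have cancel: "P i * ((p i - P i) / P i) = p i - P i" if "i \<in> A" for i
    using P[OF that] by simp
  have le: "P i * ln (p i) \<le> P i * ln (P i) + (p i - P i)" if "i \<in> A" for i
    using mult_left_mono[OF ln_diff_le[OF p[OF that] P[OF that]], of "P i"] P[OF that]
    unfolding cancel[OF that] by (simp add: right_diff_distrib)
  have less: "P i * ln (p i) < P i * ln (P i) + (p i - P i)" if "i \<in> A" "p i \<noteq> P i" for i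
    using mult_strict_left_mono[OF ln_diff_less[OF p[OF that(1)] P[OF that(1)] that(2)] P[OF that(1)]]
    unfolding cancel[OF that(1)] by (simp add: right_diff_distrib)
  have eq: "(\<Sum>i\<in>A. P i * ln (P i) + (p i - P i)) = (\<Sum>i\<in>A. P i * ln (P i))"
    by (simp add: sum.distrib sum_subtractf sum)
  show ?thesis
    unfolding eq[symmetric] using ne le less by (intro sum_strict_mono_ex1[OF A]) auto
qed

section \<open>The optimal report\<close>

text \<open>The restriction to \<open>{1..K}\<close> makes this a point of the extensional simplex,
  so that it can be equal, as a function, to an optimal report.\<close>

definition dirichlet_mean :: "nat \<Rightarrow> (nat \<Rightarrow> real) \<Rightarrow> nat \<Rightarrow> real" where
  "dirichlet_mean K \<alpha> = (\<lambda>x\<in>{1..K}. \<alpha> x / (\<Sum>i=1..K. \<alpha> i))"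

definition collision_prob :: "nat \<Rightarrow> (nat \<Rightarrow> real) \<Rightarrow> real" where
  "collision_prob K \<alpha> = (\<Sum>x=1..K. pair_weight K \<alpha> (x, x))"

lemma dirichlet_mean_pos:
  assumes "K \<ge> 1" "\<forall>j\<in>{1..K}. \<alpha> j > 0" "x \<in> {1..K}"
  shows "dirichlet_mean K \<alpha> x > 0"
  using assms sum_param_pos[OF assms(1,2)] by (simp add: dirichlet_mean_def)

lemma dirichlet_mean_in_simplex:
  assumes "K \<ge> 1" "\<forall>j\<in>{1..K}. \<alpha> j > 0"
  shows "dirichlet_mean K \<alpha> \<in> prob_simplex K"
proof -
  have "(\<Sum>x=1..K. dirichlet_mean K \<alpha> x) = 1"
    using sum_param_pos[OF assms] by (simp add: dirichlet_mean_def flip: sum_divide_distrib)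
  then show ?thesis
    using less_imp_le[OF dirichlet_mean_pos[OF assms]]
    by (auto simp: prob_simplex_def PiE_iff dirichlet_mean_def)
qed

lemma pair_weight_pos:
  assumes "K \<ge> 1" "\<forall>j\<in>{1..K}. \<alpha> j > 0" "z \<in> {1..K} \<times> {1..K}"
  shows "pair_weight K \<alpha> z > 0"
  using assms sum_param_pos[OF assms(1,2)]
  by (auto simp: pair_weight_def split_beta intro!: divide_pos_pos mult_pos_pos add_pos_nonneg)

text \<open>After a first draw of \<open>x\<close> the urn has total mass \<open>n + 1\<close>, so
  the second-draw probabilities sum to 1 and only the marginal of the first sample is left.\<close>

lemma sum_pair_weight:
  assumes "K \<ge> 1" "\<forall>j\<in>{1..K}. \<alpha> j > 0" "x \<in> {1..K}"
  shows "(\<Sum>y=1..K. pair_weight K \<alpha> (x, y)) = dirichlet_mean K \<alpha> x"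
proof -
  let ?n = "\<Sum>i=1..K. \<alpha> i"
  have "(\<Sum>y=1..K. \<alpha> y + of_bool (x = y)) = ?n + 1"
    using assms(3) by (simp add: sum.distrib)
  then have "(\<Sum>y=1..K. (\<alpha> y + of_bool (x = y)) / (?n + 1)) = 1"
    using sum_param_pos[OF assms(1,2)] unfolding sum_divide_distrib[symmetric] by simp
  then show ?thesis
    unfolding pair_weight_def prod.case sum_distrib_left[symmetric]
    using assms(3) by (simp add: dirichlet_mean_def)
qed

text \<open>Each diagonal weight is at most its row sum, and the row sums add up to 1.\<close>

lemma collision_prob_bounds:
  assumes "K \<ge> 1" "\<forall>j\<in>{1..K}. \<alpha> j > 0"
  shows "collision_prob K \<alpha> \<in> {0..1}"
proof -
  have "pair_weight K \<alpha> (x, x) \<le> dirichlet_mean K \<alpha> x" if "x \<in> {1..K}" for x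
    unfolding sum_pair_weight[OF assms that, symmetric]
    using that less_imp_le[OF pair_weight_pos[OF assms]]
    by (intro member_le_sum[of x "{1..K}" "\<lambda>y. pair_weight K \<alpha> (x, y)"]) auto
  then have "collision_prob K \<alpha> \<le> (\<Sum>x=1..K. dirichlet_mean K \<alpha> x)"
    unfolding collision_prob_def by (rule sum_mono)
  moreover have "collision_prob K \<alpha> \<ge> 0"
    unfolding collision_prob_def using less_imp_le[OF pair_weight_pos[OF assms]]
    by (intro sum_nonneg) auto
  ultimately show ?thesis
    using simplex_sum[OF dirichlet_mean_in_simplex[OF assms]] by simp
qed

text \<open>With all \<open>p i\<close> positive every score is a real number, so the expectation is
  a finite sum. The logarithm depends on the first sample alone and is averaged by the marginal; the
  reward for a collision is collected on the diagonal.\<close>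

lemma expected_score_pos:
  fixes X :: "nat multiset"
  assumes K: "K \<ge> 1" and pos: "\<forall>j\<in>{1..K}. \<alpha> j > 0" and p: "\<And>i. i \<in> {1..K} \<Longrightarrow> p i > 0"
  defines "\<beta> \<equiv> posterior_param \<alpha> X"
  shows "expected_score K \<alpha> log_quadratic_mechanism X (p, b) =
    ereal ((\<Sum>i=1..K. dirichlet_mean K \<beta> i * ln (p i)) + 2 * b * collision_prob K \<beta> - b\<^sup>2)"
proof -
  have pos': "\<forall>j\<in>{1..K}. \<beta> j > 0" unfolding \<beta>_def by (rule posterior_param_pos[OF pos])
  let ?w = "pair_weight K \<beta>"
  let ?f = "\<lambda>z::nat \<times> nat. ln (p (fst z)) + 2 * b * of_bool (fst z = snd z) - b\<^sup>2"
  have "expected_score K \<alpha> log_quadratic_mechanism X (p, b) =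
      ereal (\<Sum>z\<in>{1..K} \<times> {1..K}. ?w z * ?f z)"
    unfolding expected_score_def belief_eq_point_measure[OF K pos] \<beta>_def[symmetric]
  proof (rule ereal_expectation_point_measure)
    fix z :: "nat \<times> nat" assume z: "z \<in> {1..K} \<times> {1..K}"
    then show "?w z \<ge> 0" by (rule less_imp_le[OF pair_weight_pos[OF K pos']])
    have "p (fst z) > 0" using z by (intro p) auto
    then show "(case z of (x1, x2) \<Rightarrow> log_quadratic_mechanism (fst (p, b)) (snd (p, b)) x1 x2) =
        ereal (?f z)"
      by (simp add: split_beta log_quadratic_mechanism_def ext_ln_def)
  qed simp
  \<comment> \<open>The collision term is written as an \<open>if\<close>, so that the inner sum
    over \<open>y\<close> picks out the diagonal entry.\<close>
  also have "(\<Sum>z\<in>{1..K} \<times> {1..K}. ?w z * ?f z) =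
      (\<Sum>x=1..K. \<Sum>y=1..K. ?w (x, y) * (ln (p x) - b\<^sup>2) + (if x = y then 2 * b * ?w (x, y) else 0))"
    unfolding sum.cartesian_product by (intro sum.cong) (auto simp: algebra_simps)
  also have "\<dots> = (\<Sum>x=1..K. dirichlet_mean K \<beta> x * (ln (p x) - b\<^sup>2) + 2 * b * ?w (x, x))"
  proof (rule sum.cong[OF refl])
    fix x assume x: "x \<in> {1..K}"
    then show "(\<Sum>y=1..K. ?w (x, y) * (ln (p x) - b\<^sup>2) + (if x = y then 2 * b * ?w (x, y) else 0)) =
        dirichlet_mean K \<beta> x * (ln (p x) - b\<^sup>2) + 2 * b * ?w (x, x)"
      by (simp only: sum.distrib sum_distrib_right[symmetric] sum_pair_weight[OF K pos' x]) simp
  qed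
  also have "\<dots> = (\<Sum>i=1..K. dirichlet_mean K \<beta> i * ln (p i)) + 2 * b * collision_prob K \<beta> - b\<^sup>2"
  proof -
    have "(\<Sum>x=1..K. dirichlet_mean K \<beta> x * b\<^sup>2) = b\<^sup>2"
      unfolding sum_distrib_right[symmetric]
      using simplex_sum[OF dirichlet_mean_in_simplex[OF K pos']] by simp
    then show ?thesis
      by (simp only: collision_prob_def sum.distrib right_diff_distrib sum_subtractf sum_distrib_left)
  qed
  finally show ?thesis .
qed

text \<open>The pair \<open>(i, i)\<close> has positive weight and score
  \<open>-\<infinity>\<close>, while no score equals \<open>\<infinity>\<close>.\<close>

lemma expected_score_MInf:
  assumes K: "K \<ge> 1" and pos: "\<forall>j\<in>{1..K}. \<alpha> j > 0" and i: "i \<in> {1..K}" "p i = 0"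
  shows "expected_score K \<alpha> log_quadratic_mechanism X (p, b) = -\<infinity>"
  unfolding expected_score_def belief_eq_point_measure[OF K pos]
proof (rule ereal_expectation_point_measure_MInf)
  show "(i, i) \<in> {1..K} \<times> {1..K}" using i by simp
  then show "pair_weight K (posterior_param \<alpha> X) (i, i) > 0"
    by (rule pair_weight_pos[OF K posterior_param_pos[OF pos]])
qed (auto simp: log_quadratic_mechanism_def ext_ln_def i split: if_splits)

text \<open>A report with a zero coordinate scores \<open>-\<infinity>\<close> against a finite
  optimum. Otherwise the score separates into a part in \<open>p\<close>, handled by Gibbs'
  inequality, and a quadratic in \<open>b\<close>; the inequality is strict in whichever component
  differs.\<close>

lemma expected_score_strict_max:
  fixes X :: "nat multiset"
  assumes K: "K \<ge> 1" and pos: "\<forall>j\<in>{1..K}. \<alpha> j > 0" and r: "r \<in> report_space K"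
  defines "\<beta> \<equiv> posterior_param \<alpha> X"
  assumes ne: "r \<noteq> (dirichlet_mean K \<beta>, collision_prob K \<beta>)"
  shows "expected_score K \<alpha> log_quadratic_mechanism X r <
    expected_score K \<alpha> log_quadratic_mechanism X (dirichlet_mean K \<beta>, collision_prob K \<beta>)"
proof -
  have pos': "\<forall>j\<in>{1..K}. \<beta> j > 0" unfolding \<beta>_def by (rule posterior_param_pos[OF pos])
  let ?P = "dirichlet_mean K \<beta>" and ?q = "collision_prob K \<beta>"
  have score: "expected_score K \<alpha> log_quadratic_mechanism X (u, c) =
      ereal ((\<Sum>i=1..K. ?P i * ln (u i)) + 2 * c * ?q - c\<^sup>2)" if "\<forall>i\<in>{1..K}. u i > 0" for u c
    unfolding \<beta>_def using that by (intro expected_score_pos[OF K pos]) auto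
  obtain p b where rpb: "r = (p, b)" by fastforce
  have p: "p \<in> prob_simplex K" using r rpb by (simp add: report_space_def)
  have P: "?P \<in> prob_simplex K" by (rule dirichlet_mean_in_simplex[OF K pos'])
  have Ppos: "?P i > 0" if "i \<in> {1..K}" for i by (rule dirichlet_mean_pos[OF K pos' that])
  have score_opt: "expected_score K \<alpha> log_quadratic_mechanism X (?P, ?q) =
      ereal ((\<Sum>i=1..K. ?P i * ln (?P i)) + 2 * ?q * ?q - ?q\<^sup>2)"
    by (rule score) (use Ppos in blast)
  show ?thesis
  proof (cases "\<exists>i\<in>{1..K}. p i = 0")
    case True
    then have "expected_score K \<alpha> log_quadratic_mechanism X (p, b) = -\<infinity>"
      using expected_score_MInf[OF K pos, of _ p X b] by blast
    then show ?thesis by (simp only: rpb score_opt) simp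
  next
    case False
    then have ppos: "p i > 0" if "i \<in> {1..K}" for i
      using simplex_nonneg[OF p that] that by force
    have score_p: "expected_score K \<alpha> log_quadratic_mechanism X (p, b) =
        ereal ((\<Sum>i=1..K. ?P i * ln (p i)) + 2 * b * ?q - b\<^sup>2)"
      by (rule score) (use ppos in blast)
    have sums: "sum p {1..K} = sum ?P {1..K}" by (simp only: simplex_sum[OF p] simplex_sum[OF P])
    \<comment> \<open>Completing the square shows that the quadratic part peaks exactly at the
      collision probability.\<close>
    have square: "2 * c * ?q - c\<^sup>2 = ?q\<^sup>2 - (c - ?q)\<^sup>2" for c
      by (simp add: power2_eq_square algebra_simps)
    have "(\<Sum>i=1..K. ?P i * ln (p i)) - (b - ?q)\<^sup>2 < (\<Sum>i=1..K. ?P i * ln (?P i))"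
    proof (cases "p = ?P")
      case True
      then show ?thesis using ne rpb by simp
    next
      case False
      \<comment> \<open>Both points are extensional, so distinct functions already differ at an
        index in \<open>{1..K}\<close>.\<close>
      then have "\<exists>i\<in>{1..K}. p i \<noteq> ?P i"
        using p P PiE_ext[of p "{1..K}" "\<lambda>_. {0..}" ?P] unfolding prob_simplex_def by blast
      then have "(\<Sum>i=1..K. ?P i * ln (p i)) < (\<Sum>i=1..K. ?P i * ln (?P i))"
        using Ppos ppos sums by (intro gibbs_inequality) auto
      then show ?thesis using zero_le_power2[of "b - ?q"] by linarith
    qed
    then show ?thesis
      unfolding rpb score_opt score_p using square[of b] square[of ?q] by simp
  qed
qed

lemma optimal_report_iff:
  fixes X :: "nat multiset"
  assumes K: "K \<ge> 1" and pos: "\<forall>j\<in>{1..K}. \<alpha> j > 0"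
  defines "\<beta> \<equiv> posterior_param \<alpha> X"
  shows "optimal_report K \<alpha> log_quadratic_mechanism X r \<longleftrightarrow>
    r = (dirichlet_mean K \<beta>, collision_prob K \<beta>)"
proof -
  have pos': "\<forall>j\<in>{1..K}. \<beta> j > 0" unfolding \<beta>_def by (rule posterior_param_pos[OF pos])
  have "(dirichlet_mean K \<beta>, collision_prob K \<beta>) \<in> report_space K"
    using dirichlet_mean_in_simplex[OF K pos'] collision_prob_bounds[OF K pos']
    by (simp add: report_space_def)
  then show ?thesis
    unfolding optimal_report_def is_arg_max_def
    using expected_score_strict_max[OF K pos, of _ X, folded \<beta>_def] by (metis less_asym)
qed

text \<open>With \<open>s = \<Sum>x. P\<^sub>x\<^sup>2\<close> the collision probability is \<open>q = (n s + 1) / (n + 1)\<close>, which determines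
  the total mass \<open>n\<close> because \<open>s < 1\<close> as soon as \<open>K \<ge> 2\<close>.\<close>

lemma dirichlet_report_inj:
  assumes K: "K \<ge> 2" and pos: "\<forall>j\<in>{1..K}. \<alpha> j > 0" and pos': "\<forall>j\<in>{1..K}. \<beta> j > 0"
    and mean: "dirichlet_mean K \<alpha> = dirichlet_mean K \<beta>"
    and coll: "collision_prob K \<alpha> = collision_prob K \<beta>" and x: "x \<in> {1..K}"
  shows "\<alpha> x = \<beta> x"
proof -
  have K1: "K \<ge> 1" using K by simp
  let ?P = "dirichlet_mean K \<alpha>"
  define s where "s = (\<Sum>x=1..K. (?P x)\<^sup>2)"
  have P: "?P \<in> prob_simplex K" by (rule dirichlet_mean_in_simplex[OF K1 pos])
  have Ppos: "?P i > 0" if "i \<in> {1..K}" for i by (rule dirichlet_mean_pos[OF K1 pos that])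
  \<comment> \<open>This is where \<open>K \<ge> 2\<close> enters: a second index carries positive
    mass. It makes every square strictly smaller than its entry, whence
    \<open>s < 1\<close>.\<close>
  have P1: "?P i < 1" if i: "i \<in> {1..K}" for i
  proof -
    obtain j where j: "j \<in> {1..K}" "j \<noteq> i"
      using K by (cases "i = 1") (auto intro: that[of 1] that[of 2])
    have "?P i + ?P j = sum ?P {i, j}" using j by simp
    also have "\<dots> \<le> sum ?P {1..K}"
      using i j less_imp_le[OF Ppos] by (intro sum_mono2) auto
    finally show ?thesis using simplex_sum[OF P] Ppos[OF j(1)] by simp
  qed
  have "s < sum ?P {1..K}" unfolding s_def
    using K Ppos P1 by (intro sum_strict_mono) (auto simp: power2_eq_square)
  then have s1: "s < 1" using simplex_sum[OF P] by simp
  \<comment> \<open>Stated for any parameter with mean \<open>?P\<close>, so that it applies to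
    \<alpha> and to \<beta> with the same \<open>s\<close>.\<close>
  have key: "collision_prob K \<gamma> * (n + 1) = n * s + 1"
    if g: "\<forall>j\<in>{1..K}. \<gamma> j > 0" "dirichlet_mean K \<gamma> = ?P" and n: "n = (\<Sum>i=1..K. \<gamma> i)" for \<gamma> n
  proof -
    have n0: "n > 0" unfolding n by (rule sum_param_pos[OF K1 g(1)])
    have "pair_weight K \<gamma> (x, x) * (n + 1) = n * (?P x)\<^sup>2 + ?P x" if "x \<in> {1..K}" for x
    proof -
      have "?P x = \<gamma> x / n"
        using fun_cong[OF g(2), of x] that by (simp add: dirichlet_mean_def n)
      moreover have "\<gamma> x / n * ((\<gamma> x + 1) / (n + 1)) * (n + 1) = n * (\<gamma> x / n)\<^sup>2 + \<gamma> x / n"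
      proof -
        have "n + 1 \<noteq> 0" "n \<noteq> 0" using n0 by auto
        then have "(\<gamma> x + 1) / (n + 1) * (n + 1) = \<gamma> x + 1" "n * (\<gamma> x / n) = \<gamma> x" by simp_all
        then show ?thesis unfolding power2_eq_square mult.assoc
          by (simp only: mult.assoc[symmetric]) (simp add: algebra_simps add_divide_distrib)
      qed
      ultimately show ?thesis by (simp add: pair_weight_def n)
    qed
    then have "collision_prob K \<gamma> * (n + 1) = (\<Sum>x=1..K. n * (?P x)\<^sup>2 + ?P x)"
      unfolding collision_prob_def sum_distrib_right by (intro sum.cong) auto
    also have "\<dots> = n * s + 1"
      unfolding s_def sum.distrib sum_distrib_left[symmetric] simplex_sum[OF P] ..
    finally show ?thesis .
  qed
  define q where "q = collision_prob K \<alpha>"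
  define n n' where "n = (\<Sum>i=1..K. \<alpha> i)" and "n' = (\<Sum>i=1..K. \<beta> i)"
  have q: "q * (n + 1) = n * s + 1" "q * (n' + 1) = n' * s + 1"
    using key[OF pos refl n_def] key[OF pos' mean[symmetric] n'_def] by (simp_all add: q_def coll)
  \<comment> \<open>The difference of the two equations in \<open>q\<close>. The first factor cannot
    vanish, since \<open>q = s\<close> in either equation would force \<open>s = 1\<close>.\<close>
  then have "(q - s) * (n - n') = 0" by (simp add: algebra_simps)
  moreover have "q \<noteq> s" using q(1) s1 by (auto simp: algebra_simps)
  ultimately have n: "n = n'" by simp
  have "\<alpha> x / n = \<beta> x / n'"
    using fun_cong[OF mean, of x] x by (simp add: dirichlet_mean_def n_def n'_def)
  moreover have "n' > 0" unfolding n'_def by (rule sum_param_pos[OF K1 pos'])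
  ultimately show ?thesis using n by simp
qed

section \<open>Pooling the reports\<close>

theorem theorem4:
  fixes K m :: nat and \<alpha>0 :: "nat \<Rightarrow> real"
  assumes "K \<ge> 1"
    and "\<forall>j\<in>{1..K}. \<alpha>0 j > 0"
  shows "achieves_optimal_aggregation K \<alpha>0 m log_quadratic_mechanism"
proof -
  note K = assms(1) and pos = assms(2)
  note param_pos = posterior_param_pos[OF pos]
  define R where "R X = (dirichlet_mean K (posterior_param \<alpha>0 X),
    collision_prob K (posterior_param \<alpha>0 X))" for X
  let ?D = "{X. set_mset X \<subseteq> {1..K}}"
  have opt: "optimal_report K \<alpha>0 log_quadratic_mechanism X r \<longleftrightarrow> r = R X" for X r
    unfolding R_def by (rule optimal_report_iff[OF K pos])
  have pred: "posterior_predictive K \<alpha>0 X = dirichlet_mean K (posterior_param \<alpha>0 X)" for X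
    unfolding dirichlet_mean_def by (rule posterior_predictive_eq[OF K pos])
  \<comment> \<open>Equal reports give equal posterior parameters on \<open>{1..K}\<close>.
    Subtracting the known prior leaves equal counts there, and off \<open>{1..K}\<close> all counts
    are 0.\<close>
  have inj: "inj_on R ?D" if K2: "K \<ge> 2"
  proof (rule inj_onI)
    fix X Y assume XY: "X \<in> ?D" "Y \<in> ?D" and RXY: "R X = R Y"
    have "posterior_param \<alpha>0 X j = posterior_param \<alpha>0 Y j" if "j \<in> {1..K}" for j
    proof (rule dirichlet_report_inj[OF K2 _ _ _ _ that])
      show "\<forall>j\<in>{1..K}. posterior_param \<alpha>0 X j > 0" "\<forall>j\<in>{1..K}. posterior_param \<alpha>0 Y j > 0"
        by (rule param_pos)+
    qed (use RXY in \<open>simp_all only: R_def prod.inject\<close>)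
    then have "count X j = count Y j" if "j \<in> {1..K}" for j
      using that unfolding posterior_param_def by simp
    moreover have "count X j = 0" "count Y j = 0" if "j \<notin> {1..K}" for j
      using that XY by (auto simp: count_eq_zero_iff)
    ultimately show "X = Y" by (intro multiset_eqI, case_tac "x \<in> {1..K}") simp_all
  qed
  \<comment> \<open>The principal decodes each report into a multiset and pools the results. On a
    report outside the image of \<open>R\<close>, \<open>inv_into\<close> returns an unspecified
    multiset, which still yields a point of the simplex.\<close>
  define g where "g r = posterior_predictive K \<alpha>0 (\<Sum>i=1..m. inv_into ?D R (r i))" for r
  have "g (\<lambda>i\<in>{1..m}. R (X i)) = posterior_predictive K \<alpha>0 (\<Sum>i=1..m. X i)"
    if X: "\<forall>i\<in>{1..m}. set_mset (X i) \<subseteq> {1..K}" for X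
  proof (cases "K \<ge> 2")
    case True
    have "(\<Sum>i=1..m. inv_into ?D R ((\<lambda>i\<in>{1..m}. R (X i)) i)) = (\<Sum>i=1..m. X i)"
    proof (rule sum.cong[OF refl])
      fix i assume "i \<in> {1..m}"
      then show "inv_into ?D R ((\<lambda>i\<in>{1..m}. R (X i)) i) = X i"
        using X inv_into_f_f[OF inj[OF True], of "X i"] by simp
    qed
    then show ?thesis unfolding g_def by (rule arg_cong)
  next
    case False
    with K have "K = 1" by simp
    \<comment> \<open>For \<open>K = 1\<close> decoding need not recover the samples, but the
      prediction is the same point mass for every multiset, so the choice made by
      \<open>inv_into\<close> does not matter.\<close>
    have "posterior_predictive K \<alpha>0 Y = (\<lambda>x\<in>{1..1}. 1)" for Y
      unfolding pred dirichlet_mean_def using param_pos[of Y] \<open>K = 1\<close> by (auto intro!: restrict_ext)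
    then show ?thesis by (simp add: g_def)
  qed
  moreover have "g r \<in> prob_simplex K" for r
    unfolding g_def pred by (rule dirichlet_mean_in_simplex[OF K param_pos])
  ultimately show ?thesis
    unfolding achieves_optimal_aggregation_def opt by (intro conjI bexI[of _ g]) auto
qed

end
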